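(* Let $a, b \in \mathbb{R}^{n\times n}$ with $n = 2^{k_{\max}} N_b$ for integers $k_{\max}\ge 0$ and $N_b \ge 1$, let $\tau \ge 0$, and let $\tau_{ab} = \tau \,\|a\|\,\|b\|$, where $\|\cdot\|$ is the Frobenius norm. Let $a \otimes_\tau b \in \mathbb{R}^{n\times n}$ be the SpAMM product of $a$ and $b$ with parameter $\tau$, recursion depth $k_{\max}$ and leaf block size $N_b$, and let $a\cdot b$ be the ordinary matrix product. Then for each $i,j \in \{1,\dots,n\}$, $$\left| (a\otimes_\tau b)_{ij} - (a\cdot b)_{ij} \right| \le n\,\tau_{ab},$$ and $$\left\| a\otimes_\tau b - a\cdot b \right\| \le n^2\,\tau_{ab}.$$
   Context: Throughout, $\|\cdot\|$ denotes the Frobenius norm, $\|m\| = \big(\sum_{i,j} |m_{ij}|^2\big)^{1/2}$, for matrices of any size. Quadtree decomposition: a square matrix of size $2^{k}N_b$ with $k\ge 1$ is partitioned into four equal square blocks of size $2^{k-1}N_b$, $$m = \begin{bmatrix} m_{00} & m_{01} \\ m_{10} & m_{11}\end{bmatrix};$$ a matrix of size $N_b$ (that is, $k=0$) is called a leaf and is not subdivided further. SpAMM (Sparse Approximate Matrix Multiply) product: fix root matrices $a,b\in\mathbb{R}^{n\times n}$, $n=2^{k_{\max}}N_b$, and the threshold $\tau_{ab}=\tau\|a\|\|b\|$. This threshold is computed once from the root matrices and stays the same at all levels of the recursion. For square matrices $p,q$ of equal size $2^{k}N_b$, $0\le k\le k_{\max}$, define $p\otimes_\tau q$ recursively by the first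 applicable rule: 1. if $\|p\|\,\|q\| < \tau_{ab}$, then $p\otimes_\tau q = 0$; 2. otherwise, if $k=0$ (leaf), then $p\otimes_\tau q = p\cdot q$, the ordinary matrix product; 3. otherwise, $$p\otimes_\tau q = \begin{bmatrix} p_{00}\otimes_\tau q_{00} + p_{01}\otimes_\tau q_{10} & p_{00}\otimes_\tau q_{01} + p_{01}\otimes_\tau q_{11} \\ p_{10}\otimes_\tau q_{00} + p_{11}\otimes_\tau q_{10} & p_{10}\otimes_\tau q_{01} + p_{11}\otimes_\tau q_{11}\end{bmatrix}.$$ The SpAMM product $a\otimes_\tau b$ is the result of applying this recursion to $p=a$, $q=b$. *)

theory Defs
  imports Complex_Main "Jordan_Normal_Form.Matrix"
begin

definition frob_norm :: "real mat \<Rightarrow> real" where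
  "frob_norm m = sqrt (\<Sum>i<dim_row m. \<Sum>j<dim_col m. \<bar>m $$ (i, j)\<bar>\<^sup>2)"

text \<open>
  \<open>spamm_rec \<theta> N\<^sub>b k p q\<close> is the recursion on square matrices of size \<open>2 ^ k * N\<^sub>b\<close>, with a fixed
  threshold \<open>\<theta>\<close> passed unchanged to every level. Its values on matrices of any other size are
  irrelevant. As \<open>split_block\<close> takes the size of the top left block, \<open>2 ^ k * N\<^sub>b\<close> cuts a matrix of
  size \<open>2 ^ Suc k * N\<^sub>b\<close> into its four equal quadrants.
\<close>

fun spamm_rec :: "real \<Rightarrow> nat \<Rightarrow> nat \<Rightarrow> real mat \<Rightarrow> real mat \<Rightarrow> real mat" where
  "spamm_rec \<theta> Nb 0 p q =
    (if frob_norm p * frob_norm q < \<theta> then 0\<^sub>m (dim_row p) (dim_col q)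
     else p * q)"
| "spamm_rec \<theta> Nb (Suc k) p q =
    (if frob_norm p * frob_norm q < \<theta> then 0\<^sub>m (dim_row p) (dim_col q)
     else
       (let s = 2 ^ k * Nb;
            (p00, p01, p10, p11) = split_block p s s;
            (q00, q01, q10, q11) = split_block q s s
        in four_block_mat
             (spamm_rec \<theta> Nb k p00 q00 + spamm_rec \<theta> Nb k p01 q10)
             (spamm_rec \<theta> Nb k p00 q01 + spamm_rec \<theta> Nb k p01 q11)
             (spamm_rec \<theta> Nb k p10 q00 + spamm_rec \<theta> Nb k p11 q10)
             (spamm_rec \<theta> Nb k p10 q01 + spamm_rec \<theta> Nb k p11 q11)))"

definition spamm_threshold :: "real \<Rightarrow> real mat \<Rightarrow> real mat \<Rightarrow> real" where
  "spamm_threshold \<tau> a b = \<tau> * frob_norm a * frob_norm b"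

definition spamm :: "real \<Rightarrow> nat \<Rightarrow> nat \<Rightarrow> real mat \<Rightarrow> real mat \<Rightarrow> real mat" where
  "spamm \<tau> Nb kmax a b = spamm_rec (spamm_threshold \<tau> a b) Nb kmax a b"

lemma spamm_rec_carrier:
  assumes "p \<in> carrier_mat (2 ^ k * Nb) (2 ^ k * Nb)"
    and "q \<in> carrier_mat (2 ^ k * Nb) (2 ^ k * Nb)"
  shows "spamm_rec \<theta> Nb k p q \<in> carrier_mat (2 ^ k * Nb) (2 ^ k * Nb)"
  using assms
proof (induction k arbitrary: p q)
  case 0
  then show ?case by auto
next
  case (Suc k)
  let ?s = "2 ^ k * Nb"
  obtain p00 p01 p10 p11 where p: "split_block p ?s ?s = (p00, p01, p10, p11)"
    by (cases "split_block p ?s ?s") auto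
  obtain q00 q01 q10 q11 where q: "split_block q ?s ?s = (q00, q01, q10, q11)"
    by (cases "split_block q ?s ?s") auto
  have sz: "2 ^ Suc k * Nb = ?s + ?s" by simp
  have dims: "dim_row p = ?s + ?s" "dim_col p = ?s + ?s"
      "dim_row q = ?s + ?s" "dim_col q = ?s + ?s"
    using Suc.prems by auto
  note pc = split_block(1-4)[OF p dims(1,2)] and qc = split_block(1-4)[OF q dims(3,4)]
  note rec = Suc.IH[OF pc(1) qc(1)] Suc.IH[OF pc(2) qc(3)] Suc.IH[OF pc(1) qc(2)]
    Suc.IH[OF pc(2) qc(4)] Suc.IH[OF pc(3) qc(1)] Suc.IH[OF pc(4) qc(3)]
    Suc.IH[OF pc(3) qc(2)] Suc.IH[OF pc(4) qc(4)]
  show ?case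
    unfolding sz using rec dims by (auto simp: Let_def p q simp del: mult_2)
qed

lemma spamm_carrier:
  assumes "a \<in> carrier_mat (2 ^ kmax * Nb) (2 ^ kmax * Nb)"
    and "b \<in> carrier_mat (2 ^ kmax * Nb) (2 ^ kmax * Nb)"
  shows "spamm \<tau> Nb kmax a b \<in> carrier_mat (2 ^ kmax * Nb) (2 ^ kmax * Nb)"
  unfolding spamm_def by (rule spamm_rec_carrier[OF assms])

end

theory Submission
  imports Defs "HOL-Analysis.L2_Norm"
begin

text \<open>
  By induction on the recursion depth, a SpAMM product with threshold \<open>\<theta>\<close> of matrices of size \<open>N\<close>
  differs from the exact product by at most \<open>N * \<theta>\<close> in every entry. A discarded product has entries
  of absolute value at most \<open>\<parallel>p\<parallel> * \<parallel>q\<parallel> < \<theta>\<close> by the Cauchy-Schwarz inequality, and each quadrant of a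
  subdivided product is a sum of two products of half the size, so that the entrywise error at most
  doubles from one level to the next. The bound on the norm follows by summing over all \<open>N\<^sup>2\<close> entries.
\<close>

lemma frob_norm_nonneg: "0 \<le> frob_norm m"
  by (simp add: frob_norm_def sum_nonneg)

lemma frob_norm_le_of_entries:
  assumes "m \<in> carrier_mat n n" and "0 \<le> c"
    and "\<And>i j. i < n \<Longrightarrow> j < n \<Longrightarrow> \<bar>m $$ (i, j)\<bar> \<le> c"
  shows "frob_norm m \<le> real n * c"
proof -
  have "(\<Sum>i<n. \<Sum>j<n. \<bar>m $$ (i, j)\<bar>\<^sup>2) \<le> (\<Sum>i<n. \<Sum>j<n. c\<^sup>2)"
    by (intro sum_mono power_mono) (auto simp: assms(3))
  also have "\<dots> = (real n * c)\<^sup>2"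
    by (simp add: power2_eq_square)
  finally show ?thesis
    using assms(1,2) by (auto simp: frob_norm_def intro!: real_le_lsqrt)
qed

text \<open>The squares from row \<open>i\<close> make up one summand of the outer sum in
  \<open>frob_norm\<close>.\<close>

lemma L2_set_row_le_frob_norm:
  assumes "i < dim_row m"
  shows "L2_set (\<lambda>j. m $$ (i, j)) {..<dim_col m} \<le> frob_norm m"
  unfolding L2_set_def frob_norm_def using assms
  by (auto intro!: real_sqrt_le_mono sum_nonneg
      member_le_sum[where f = "\<lambda>i. \<Sum>j<dim_col m. (m $$ (i, j))\<^sup>2"])

text \<open>A column is spread over the outer sum: it contributes one term to every inner sum, so
  the comparison runs row by row.\<close>

lemma L2_set_col_le_frob_norm:
  assumes "j < dim_col m"
  shows "L2_set (\<lambda>i. m $$ (i, j)) {..<dim_row m} \<le> frob_norm m"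
  unfolding L2_set_def frob_norm_def using assms
  by (auto intro!: real_sqrt_le_mono sum_mono member_le_sum)

lemma abs_index_mult_mat_le_frob_norm:
  assumes "i < dim_row p" and "j < dim_col q" and "dim_col p = dim_row q"
  shows "\<bar>(p * q) $$ (i, j)\<bar> \<le> frob_norm p * frob_norm q"
proof -
  have "\<bar>(p * q) $$ (i, j)\<bar> = \<bar>\<Sum>l<dim_col p. p $$ (i, l) * q $$ (l, j)\<bar>"
    using assms by (simp add: scalar_prod_def atLeast0LessThan)
  also have "\<dots> \<le> (\<Sum>l<dim_col p. \<bar>p $$ (i, l)\<bar> * \<bar>q $$ (l, j)\<bar>)"
    by (metis (no_types, lifting) abs_mult sum_abs sum.cong)
  also have "\<dots> \<le> L2_set (\<lambda>l. p $$ (i, l)) {..<dim_col p} * L2_set (\<lambda>l. q $$ (l, j)) {..<dim_row q}"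
    using assms(3) by (simp add: L2_set_mult_ineq)
  also have "\<dots> \<le> frob_norm p * frob_norm q"
    by (intro mult_mono L2_set_row_le_frob_norm L2_set_col_le_frob_norm L2_set_nonneg
        frob_norm_nonneg assms)
  finally show ?thesis .
qed

text \<open>Each entry of a block matrix lies in exactly one block, so a bound common to the four
  blocks passes to the whole without growing.\<close>

lemma abs_index_four_block_mat_diff_le:
  fixes A B C D A' B' C' D' :: "real mat"
  assumes "A \<in> carrier_mat s s" "B \<in> carrier_mat s s" "C \<in> carrier_mat s s" "D \<in> carrier_mat s s"
    and "A' \<in> carrier_mat s s" "B' \<in> carrier_mat s s" "C' \<in> carrier_mat s s" "D' \<in> carrier_mat s s"
    and "\<And>i j. i < s \<Longrightarrow> j < s \<Longrightarrow> \<bar>A $$ (i, j) - A' $$ (i, j)\<bar> \<le> c"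
    and "\<And>i j. i < s \<Longrightarrow> j < s \<Longrightarrow> \<bar>B $$ (i, j) - B' $$ (i, j)\<bar> \<le> c"
    and "\<And>i j. i < s \<Longrightarrow> j < s \<Longrightarrow> \<bar>C $$ (i, j) - C' $$ (i, j)\<bar> \<le> c"
    and "\<And>i j. i < s \<Longrightarrow> j < s \<Longrightarrow> \<bar>D $$ (i, j) - D' $$ (i, j)\<bar> \<le> c"
    and "i < s + s" and "j < s + s"
  shows "\<bar>four_block_mat A B C D $$ (i, j) - four_block_mat A' B' C' D' $$ (i, j)\<bar> \<le> c"
  using assms by simp

text \<open>The threshold is decoupled from the norms of \<open>p\<close> and \<open>q\<close>,
  because the recursion compares ever smaller blocks with the same \<theta>; only the root call ties
  it to its arguments.\<close>

lemma spamm_rec_entry_error: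
  assumes "0 \<le> \<theta>"
    and "p \<in> carrier_mat (2 ^ k * Nb) (2 ^ k * Nb)"
    and "q \<in> carrier_mat (2 ^ k * Nb) (2 ^ k * Nb)"
    and "i < 2 ^ k * Nb" and "j < 2 ^ k * Nb"
  shows "\<bar>spamm_rec \<theta> Nb k p q $$ (i, j) - (p * q) $$ (i, j)\<bar> \<le> real (2 ^ k * Nb) * \<theta>"
  using assms(2-5)
proof (induction k arbitrary: p q i j)
  \<comment> \<open>Stated for any size \<open>N\<close>, since a product can be discarded at a leaf
    and at an inner level alike.\<close>
  have discarded: "\<bar>0\<^sub>m (dim_row p) (dim_col q) $$ (i, j) - (p * q) $$ (i, j)\<bar> \<le> real N * \<theta>"
    if "frob_norm p * frob_norm q < \<theta>" "p \<in> carrier_mat N N" "q \<in> carrier_mat N N"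
      "i < N" "j < N" for p q :: "real mat" and i j N
  proof -
    have "\<bar>(p * q) $$ (i, j)\<bar> \<le> frob_norm p * frob_norm q"
      using that by (intro abs_index_mult_mat_le_frob_norm) auto
    also have "\<dots> \<le> 1 * \<theta>"
      using that(1) by simp
    \<comment> \<open>The existence of an index \<open>i < N\<close> forces \<open>N\<close> to be
      at least 1.\<close>
    also have "\<dots> \<le> real N * \<theta>"
      using that(4) assms(1) by (intro mult_right_mono) auto
    finally show ?thesis
      using that by simp
  qed
  {
    case 0
    \<comment> \<open>A leaf product that is kept is exact, so its error 0 is within the bound as
      \<theta> is nonnegative.\<close>
    then show ?case
      using discarded[of p q Nb i j] assms(1) by auto
  next
    case (Suc k)
    let ?s = "2 ^ k * Nb"
    obtain p00 p01 p10 p11 where p: "split_block p ?s ?s = (p00, p01, p10, p11)"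
      by (cases "split_block p ?s ?s") auto
    obtain q00 q01 q10 q11 where q: "split_block q ?s ?s = (q00, q01, q10, q11)"
      by (cases "split_block q ?s ?s") auto
    have dims: "dim_row p = ?s + ?s" "dim_col p = ?s + ?s"
        "dim_row q = ?s + ?s" "dim_col q = ?s + ?s"
      using Suc.prems by auto
    note pc = split_block(1-4)[OF p dims(1,2)] and qc = split_block(1-4)[OF q dims(3,4)]
    show ?case
    proof (cases "frob_norm p * frob_norm q < \<theta>")
      case True
      then show ?thesis
        using discarded[OF True Suc.prems] by simp
    next
      case False
      \<comment> \<open>Each of the two summands errs by at most \<open>?s * \<theta>\<close>, and
        twice \<open>?s\<close> is the size of the undivided matrix. Product entries stay folded in
        the proof so that they match the induction hypothesis.\<close>
      have quadrant: "\<bar>(spamm_rec \<theta> Nb k u v + spamm_rec \<theta> Nb k w x) $$ (i, j)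
            - (u * v + w * x) $$ (i, j)\<bar> \<le> real (2 ^ Suc k * Nb) * \<theta>"
        if uvwx: "u \<in> carrier_mat ?s ?s" "v \<in> carrier_mat ?s ?s"
          "w \<in> carrier_mat ?s ?s" "x \<in> carrier_mat ?s ?s" and ij: "i < ?s" "j < ?s"
        for u v w x i j
        using Suc.IH[OF uvwx(1,2) ij] Suc.IH[OF uvwx(3,4) ij] uvwx ij
          spamm_rec_carrier[OF uvwx(1,2), of \<theta>] spamm_rec_carrier[OF uvwx(3,4), of \<theta>]
        by (simp add: algebra_simps del: index_mult_mat(1))
      \<comment> \<open>The exact product obeys the block formula of the recursion, so the two can
        be compared quadrant by quadrant.\<close>
      have prod: "p * q = four_block_mat (p00 * q00 + p01 * q10) (p00 * q01 + p01 * q11)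
          (p10 * q00 + p11 * q10) (p10 * q01 + p11 * q11)"
        unfolding split_block(5)[OF p dims(1,2)] split_block(5)[OF q dims(3,4)]
        by (rule mult_four_block_mat[OF pc qc])
      have rec: "spamm_rec \<theta> Nb (Suc k) p q = four_block_mat
             (spamm_rec \<theta> Nb k p00 q00 + spamm_rec \<theta> Nb k p01 q10)
             (spamm_rec \<theta> Nb k p00 q01 + spamm_rec \<theta> Nb k p01 q11)
             (spamm_rec \<theta> Nb k p10 q00 + spamm_rec \<theta> Nb k p11 q10)
             (spamm_rec \<theta> Nb k p10 q01 + spamm_rec \<theta> Nb k p11 q11)"
        using False by (simp add: Let_def p q)
      note carrier = spamm_rec_carrier[where \<theta> = \<theta>]
      show ?thesis
        unfolding prod rec
      proof (rule abs_index_four_block_mat_diff_le[where s = ?s])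
        show "i < ?s + ?s" "j < ?s + ?s"
          using Suc.prems(3,4) by auto
      qed (use pc qc in \<open>auto intro!: quadrant add_carrier_mat mult_carrier_mat carrier
            simp del: index_mult_mat(1) index_add_mat(1) power_Suc of_nat_mult\<close>)
    qed
  }
qed

theorem proposition2p1:
  fixes a b :: "real mat" and n kmax Nb :: nat and \<tau> :: real
  assumes "Nb \<ge> 1"
    and "n = 2 ^ kmax * Nb"
    and "a \<in> carrier_mat n n"
    and "b \<in> carrier_mat n n"
    and "\<tau> \<ge> 0"
  shows "(\<forall>i<n. \<forall>j<n.
            \<bar>spamm \<tau> Nb kmax a b $$ (i, j) - (a * b) $$ (i, j)\<bar>
              \<le> real n * spamm_threshold \<tau> a b)
       \<and> frob_norm (spamm \<tau> Nb kmax a b - a * b) \<le> (real n)\<^sup>2 * spamm_threshold \<tau> a b"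
proof -
  have nonneg: "0 \<le> spamm_threshold \<tau> a b"
    using assms(5) by (simp add: spamm_threshold_def frob_norm_nonneg)
  have entry: "\<bar>spamm \<tau> Nb kmax a b $$ (i, j) - (a * b) $$ (i, j)\<bar> \<le> real n * spamm_threshold \<tau> a b"
    if "i < n" "j < n" for i j
    unfolding spamm_def assms(2)
    using spamm_rec_entry_error[OF nonneg] that assms(2-4) by blast
  have "spamm \<tau> Nb kmax a b - a * b \<in> carrier_mat n n"
    using assms(3,4) by auto
  \<comment> \<open>The second factor \<open>n\<close> is the square root of the number of
    entries.\<close>
  then have "frob_norm (spamm \<tau> Nb kmax a b - a * b) \<le> real n * (real n * spamm_threshold \<tau> a b)"
  proof (rule frob_norm_le_of_entries)
    show "0 \<le> real n * spamm_threshold \<tau> a b"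
      using nonneg by simp
    show "\<bar>(spamm \<tau> Nb kmax a b - a * b) $$ (i, j)\<bar> \<le> real n * spamm_threshold \<tau> a b"
      if "i < n" "j < n" for i j
      using entry[OF that] that assms(3,4) by (simp del: index_mult_mat(1))
  qed
  then show ?thesis
    using entry by (simp add: power2_eq_square mult.assoc)
qed

end
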